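(* Let $q$ be a complex number with $|q|=1$ that is not a root of unity, and let $p$ be a real number with $0<p<1$. For $n=0,1,2,\dots$ let $$\Phi_n(z)=p^n\,\frac{(p^{-1};q)_n}{(pq;q)_n}\;{_2}\phi_1\left({q^{-n},\,pq \atop pq^{1-n}};\,zq\right),\qquad A_n=\frac{(pq;q)_n}{(q;q)_n}\,p^{-n}.$$ Then for all nonnegative integers $n,s$ the duality property $$A_s\,\Phi_s(q^n)=A_n\,\Phi_n(q^s)$$ holds.
   Context: The $q$-shifted factorial is $(a;q)_0=1$ and $(a;q)_n=(1-a)(1-aq)\cdots(1-aq^{n-1})$ for $n\ge 1$. The basic hypergeometric function (with base $q$) is $${_2}\phi_1\left({a_1,a_2\atop b_1};z\right)=\sum_{k=0}^{\infty}\frac{(a_1;q)_k(a_2;q)_k}{(q;q)_k(b_1;q)_k}z^k ;$$ when $a_1=q^{-n}$ with $n$ a nonnegative integer, the series terminates and denotes the finite sum over $0\le k\le n$. The polynomials $\Phi_n$ are the monic polynomials orthogonal on the unit circle with respect to the probability measure having mass $(1-p)p^s$ at the point $q^s$, $s=0,1,2,\dots$. *)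

theory Defs
  imports Complex_Main
begin

definition q_shifted_factorial :: "complex \<Rightarrow> complex \<Rightarrow> nat \<Rightarrow> complex" where
  "q_shifted_factorial a q n = (\<Prod>j<n. 1 - a * q ^ j)"

definition basic_hyp_2_1 ::
    "complex \<Rightarrow> complex \<Rightarrow> complex \<Rightarrow> complex \<Rightarrow> complex \<Rightarrow> complex" where
  "basic_hyp_2_1 q a1 a2 b1 z =
     (\<Sum>k. q_shifted_factorial a1 q k * q_shifted_factorial a2 q k
           / (q_shifted_factorial q q k * q_shifted_factorial b1 q k) * z ^ k)"

lemma basic_hyp_2_1_terminating:
  fixes q a2 b1 z :: complex and n :: nat
  assumes "q \<noteq> 0"
  shows "basic_hyp_2_1 q (q powi (- int n)) a2 b1 z =
     (\<Sum>k\<le>n. q_shifted_factorial (q powi (- int n)) q k * q_shifted_factorial a2 q k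
           / (q_shifted_factorial q q k * q_shifted_factorial b1 q k) * z ^ k)"
proof -
  have "q_shifted_factorial (q powi (- int n)) q k = 0" if "n < k" for k
    unfolding q_shifted_factorial_def
  proof (rule prod_zero)
    show "\<exists>j\<in>{..<k}. 1 - q powi (- int n) * q ^ j = 0"
      using that assms by (intro bexI[of _ n]) (auto simp: power_int_minus)
  qed simp
  then show ?thesis
    unfolding basic_hyp_2_1_def by (intro suminf_finite) auto
qed

definition Phi :: "complex \<Rightarrow> real \<Rightarrow> nat \<Rightarrow> complex \<Rightarrow> complex" where
  "Phi q p n z =
     of_real p ^ n
     * (q_shifted_factorial (inverse (of_real p)) q n
        / q_shifted_factorial (of_real p * q) q n)
     * basic_hyp_2_1 q (q powi (- int n)) (of_real p * q)
         (of_real p * q powi (1 - int n)) (z * q)"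

definition A_coeff :: "complex \<Rightarrow> real \<Rightarrow> nat \<Rightarrow> complex" where
  "A_coeff q p n =
     q_shifted_factorial (of_real p * q) q n / q_shifted_factorial q q n
     * of_real p powi (- int n)"

end

(* With a(n) = (1/p;q)_n/(q;q)_n and b(n) = (pq;q)_n/(q;q)_n p^(-n), reversing the q-shifted
   factorials shows that A_n Phi_n(z) is the n-th coefficient of G_z(t) = A(t) B(zt), where A, B are
   the generating functions of a, b.  The q-difference equations
     (1 - t) A(t) = (1 - t/p) A(qt)   and   (1 - t/p) B(t) = (1 - qt) B(qt)
   yield two formulas for G_{qz} in terms of G_z.  On coefficients at z = q^s these are recurrences
   that exchange under swapping n and s, so symmetry follows by induction. *)
theory Submission
  imports Defs "HOL-Computational_Algebra.Formal_Power_Series"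
begin

unbundle fps_syntax

lemma q_shifted_factorial_0 [simp]: "q_shifted_factorial a q 0 = 1"
  by (simp add: q_shifted_factorial_def)

lemma q_shifted_factorial_Suc:
  "q_shifted_factorial a q (Suc n) = q_shifted_factorial a q n * (1 - a * q ^ n)"
  by (simp add: q_shifted_factorial_def)

lemma q_shifted_factorial_nonzero:
  assumes "\<And>j. a * q ^ j \<noteq> 1"
  shows "q_shifted_factorial a q n \<noteq> 0"
  using assms by (auto simp: q_shifted_factorial_def)

text \<open>Going from \<open>k\<close> to \<open>Suc k\<close> multiplies the left side by a factor
  that, with m = n - k - 1, simplifies to (1 - q^(m+1)) / (1 - q^m/p). This strips the last factor
  from both factorials on the right. The identity turns the terminating series into a Cauchy
  product.\<close>

lemma q_shifted_factorial_quotient_reverse: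
  fixes p q :: complex
  assumes "q \<noteq> 0" "p \<noteq> 0" "\<And>j. q ^ Suc j \<noteq> 1" "\<And>j. inverse p * q ^ j \<noteq> 1" "k \<le> n"
  shows "q_shifted_factorial (q powi (- int n)) q k
      / q_shifted_factorial (p * q powi (1 - int n)) q k
      * (q_shifted_factorial (inverse p) q n / q_shifted_factorial q q n) * (p * q) ^ k
    = q_shifted_factorial (inverse p) q (n - k) / q_shifted_factorial q q (n - k)"
  using \<open>k \<le> n\<close>
proof (induction k)
  case 0
  then show ?case by simp
next
  case (Suc k)
  define m where "m = n - Suc k"
  have nk: "n - k = Suc m" and n: "n = Suc m + k"
    using Suc.prems by (auto simp: m_def)
  have "q powi (- int n) = inverse (q ^ Suc m * q ^ k)"
    by (simp only: n power_int_minus power_int_of_nat power_add)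
  then have num: "1 - q powi (- int n) * q ^ k = - (1 - q ^ Suc m) / q ^ Suc m"
    using assms(1) by (simp add: field_simps)
  have "q powi (1 - int n) * q ^ k = q powi (1 - int n + int k)"
    using assms(1) by (subst power_int_add) auto
  also have "\<dots> = q powi (- int m)"
    by (simp add: n)
  also have "\<dots> = inverse (q ^ m)"
    by (simp add: power_int_minus)
  finally have "p * q powi (1 - int n) * q ^ k = p * inverse (q ^ m)"
    by (simp add: mult.assoc)
  then have den: "1 - p * q powi (1 - int n) * q ^ k = - p * (1 - inverse p * q ^ m) / q ^ m"
    using assms(1,2) by (simp add: field_simps)
  have nz: "1 - inverse p * q ^ m \<noteq> 0" "1 - q ^ Suc m \<noteq> 0"
    using assms(3)[of m] assms(4)[of m] by auto
  \<comment> \<open>The factor \<open>p * q\<close> absorbs the -1/q^(m+1) of \<open>num\<close> and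
    the -p/q^m of \<open>den\<close>.\<close>
  have step: "(1 - q powi (- int n) * q ^ k) / (1 - p * q powi (1 - int n) * q ^ k) * (p * q)
      = (1 - q ^ Suc m) / (1 - inverse p * q ^ m)"
    unfolding num den using assms(1,2) nz by (simp add: divide_simps) (simp add: algebra_simps)
  let ?L = "\<lambda>k. q_shifted_factorial (q powi (- int n)) q k
      / q_shifted_factorial (p * q powi (1 - int n)) q k
      * (q_shifted_factorial (inverse p) q n / q_shifted_factorial q q n) * (p * q) ^ k"
  have "?L (Suc k) = ?L k * ((1 - q powi (- int n) * q ^ k)
      / (1 - p * q powi (1 - int n) * q ^ k) * (p * q))"
    by (simp add: q_shifted_factorial_Suc mult_ac)
  also have "?L k = q_shifted_factorial (inverse p) q (Suc m) / q_shifted_factorial q q (Suc m)"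
    using Suc nk by simp
  also have "\<dots> * ((1 - q powi (- int n) * q ^ k) / (1 - p * q powi (1 - int n) * q ^ k) * (p * q))
      = q_shifted_factorial (inverse p) q m / q_shifted_factorial q q m"
    unfolding step using nz by (simp add: q_shifted_factorial_Suc)
  finally show ?case
    unfolding m_def .
qed

definition a_series :: "complex \<Rightarrow> complex \<Rightarrow> complex \<Rightarrow> complex fps" where
  "a_series q p z =
     Abs_fps (\<lambda>n. q_shifted_factorial (inverse p) q n / q_shifted_factorial q q n * z ^ n)"

definition b_series :: "complex \<Rightarrow> complex \<Rightarrow> complex \<Rightarrow> complex fps" where
  "b_series q p z =
     Abs_fps (\<lambda>n. q_shifted_factorial (p * q) q n / q_shifted_factorial q q n * (z / p) ^ n)"

lemma one_minus_fps_X_mult_nth: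
  fixes F :: "complex fps"
  shows "((1 - fps_const c * fps_X) * F) $ n = F $ n - (if n = 0 then 0 else c * F $ (n - 1))"
  by (simp add: left_diff_distrib mult.assoc)

text \<open>On coefficients this is the ratio a(m+1) (1 - q^(m+1)) = a(m) (1 - q^m/p). Writing
  \<open>fps_const 1\<close> lets \<open>one_minus_fps_X_mult_nth\<close> apply to both
  sides.\<close>

lemma a_series_q_difference:
  assumes "\<And>j. q ^ Suc j \<noteq> 1"
  shows "(1 - fps_const 1 * fps_X) * a_series q p 1
    = (1 - fps_const (inverse p) * fps_X) * a_series q p q"
proof (rule fps_ext)
  fix n
  show "((1 - fps_const 1 * fps_X) * a_series q p 1) $ n
    = ((1 - fps_const (inverse p) * fps_X) * a_series q p q) $ n"
  proof (cases n)
    case (Suc m)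
    have "q_shifted_factorial q q m \<noteq> 0" "1 - q * q ^ m \<noteq> 0"
      using q_shifted_factorial_nonzero[of q q m] assms[of m] assms by auto
    then show ?thesis
      unfolding one_minus_fps_X_mult_nth Suc
      by (simp add: a_series_def q_shifted_factorial_Suc divide_simps) (simp add: algebra_simps)
  qed (simp add: one_minus_fps_X_mult_nth a_series_def)
qed

lemma b_series_q_difference:
  assumes "\<And>j. q ^ Suc j \<noteq> 1" "p \<noteq> 0"
  shows "(1 - fps_const (z / p) * fps_X) * b_series q p z
    = (1 - fps_const (z * q) * fps_X) * b_series q p (z * q)"
proof (rule fps_ext)
  fix n
  show "((1 - fps_const (z / p) * fps_X) * b_series q p z) $ n
    = ((1 - fps_const (z * q) * fps_X) * b_series q p (z * q)) $ n"
  proof (cases n)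
    case (Suc m)
    have "q_shifted_factorial q q m \<noteq> 0" "1 - q * q ^ m \<noteq> 0"
      using q_shifted_factorial_nonzero[of q q m] assms(1)[of m] assms(1) by auto
    then show ?thesis
      unfolding one_minus_fps_X_mult_nth Suc using \<open>p \<noteq> 0\<close>
      by (simp add: b_series_def q_shifted_factorial_Suc power_divide power_mult_distrib divide_simps)
        (simp add: algebra_simps)
  qed (simp add: one_minus_fps_X_mult_nth b_series_def)
qed

definition normalized_Phi :: "complex \<Rightarrow> complex \<Rightarrow> nat \<Rightarrow> complex \<Rightarrow> complex" where
  "normalized_Phi q p n z = (a_series q p 1 * b_series q p z) $ n"

lemma normalized_Phi_0 [simp]: "normalized_Phi q p 0 z = 1"
  by (simp add: normalized_Phi_def a_series_def b_series_def)

text \<open>Multiply the equation for B(zt) by A(t), which is left undilated, and compare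
  coefficients of t^(n+1).\<close>

lemma normalized_Phi_shift_argument:
  assumes "\<And>j. q ^ Suc j \<noteq> 1" "p \<noteq> 0"
  shows "normalized_Phi q p (Suc n) (z * q) - z * q * normalized_Phi q p n (z * q)
    = normalized_Phi q p (Suc n) z - z / p * normalized_Phi q p n z"
proof -
  have "(1 - fps_const (z * q) * fps_X) * (a_series q p 1 * b_series q p (z * q))
      = (1 - fps_const (z / p) * fps_X) * (a_series q p 1 * b_series q p z)"
    using b_series_q_difference[OF assms, of z] by (metis mult.left_commute)
  from arg_cong[OF this, of "\<lambda>F. F $ Suc n"] show ?thesis
    unfolding one_minus_fps_X_mult_nth normalized_Phi_def by simp
qed

text \<open>Dilating both factors by q replaces G_z(t) by G_z(qt).\<close>

lemma a_b_series_mult_nth_dilate: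
  "(a_series q p q * b_series q p (z * q)) $ n = q ^ n * normalized_Phi q p n z"
  unfolding normalized_Phi_def fps_mult_nth sum_distrib_left
proof (rule sum.cong)
  fix i assume "i \<in> {0..n}"
  then have "q ^ n = q ^ i * q ^ (n - i)"
    by (simp flip: power_add)
  then show "a_series q p q $ i * b_series q p (z * q) $ (n - i)
      = q ^ n * (a_series q p 1 $ i * b_series q p z $ (n - i))"
    by (simp add: a_series_def b_series_def power_mult_distrib power_divide)
qed simp

text \<open>Here the equation for A is multiplied by B(zqt): (1 - t) G_{qz}(t) = (1 - t/p) G_z(qt).
  The dilation on the right produces the powers of q.\<close>

lemma normalized_Phi_shift_degree:
  assumes "\<And>j. q ^ Suc j \<noteq> 1"
  shows "normalized_Phi q p (Suc n) (z * q) - normalized_Phi q p n (z * q)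
    = q ^ Suc n * normalized_Phi q p (Suc n) z - q ^ n / p * normalized_Phi q p n z"
proof -
  have "(1 - fps_const 1 * fps_X) * (a_series q p 1 * b_series q p (z * q))
      = (1 - fps_const (inverse p) * fps_X) * (a_series q p q * b_series q p (z * q))"
    by (simp only: a_series_q_difference[OF assms, of p] flip: mult.assoc)
  from arg_cong[OF this, of "\<lambda>F. F $ Suc n"] show ?thesis
    unfolding one_minus_fps_X_mult_nth a_b_series_mult_nth_dilate
    by (simp add: normalized_Phi_def divide_inverse mult_ac)
qed

lemma normalized_Phi_1:
  assumes "\<And>j. q ^ Suc j \<noteq> 1" "p \<noteq> 0" "q \<noteq> 0"
  shows "normalized_Phi q p n 1 = 1"
proof (induction n)
  case (Suc n)
  \<comment> \<open>At \<open>z = 1/q\<close> both recurrences have the same left-hand side, and their right-hand sides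
    are \<open>x\<close> and \<open>q ^ Suc n * x\<close>, so \<open>x = 0\<close>.\<close>
  define x where "x = normalized_Phi q p (Suc n) (inverse q)
    - inverse q / p * normalized_Phi q p n (inverse q)"
  have 1: "normalized_Phi q p (Suc n) 1 - normalized_Phi q p n 1 = x"
    using normalized_Phi_shift_argument[OF assms(1,2), of n "inverse q"] assms(3)
    by (simp add: x_def)
  have 2: "normalized_Phi q p (Suc n) 1 - normalized_Phi q p n 1 = q ^ Suc n * x"
    using normalized_Phi_shift_degree[OF assms(1), of p n "inverse q"] assms(3)
    by (simp add: x_def right_diff_distrib)
  from 1 2 have "(q ^ Suc n - 1) * x = 0"
    by (simp add: algebra_simps)
  then have "x = 0"
    using assms(1)[of n] by simp
  with 1 Suc show ?case by simp
qed simp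

lemma normalized_Phi_duality:
  assumes "\<And>j. q ^ Suc j \<noteq> 1" "p \<noteq> 0" "q \<noteq> 0"
  shows "normalized_Phi q p s (q ^ n) = normalized_Phi q p n (q ^ s)"
proof (induction "n + s" arbitrary: n s rule: less_induct)
  case less
  show ?case
  proof (cases "n = 0 \<or> s = 0")
    \<comment> \<open>One side has degree 0 and the other is evaluated at q^0 = 1, so both equal
      1.\<close>
    case True
    then show ?thesis
      using normalized_Phi_1[OF assms] by auto
  next
    case False
    then obtain m r where [simp]: "n = Suc m" "s = Suc r"
      by (metis not0_implies_Suc)
    have IH: "normalized_Phi q p r (q ^ m) = normalized_Phi q p m (q ^ r)"
        "normalized_Phi q p (Suc r) (q ^ m) = normalized_Phi q p m (q ^ Suc r)"
        "normalized_Phi q p r (q ^ Suc m) = normalized_Phi q p (Suc m) (q ^ r)"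
      by (intro less; simp)+
    show ?thesis
      \<comment> \<open>Write f(i,j) for \<open>normalized_Phi q p i (q ^ j)\<close>. The two
        recurrences read f(r+1,m+1) = f(r+1,m) + q^(m+1) f(r,m+1) - (q^m/p) f(r,m) and f(m+1,r+1) =
        f(m,r+1) + q^(m+1) f(m+1,r) - (q^m/p) f(m,r). \<open>IH\<close> matches the right-hand sides
        term by term.\<close>
      using normalized_Phi_shift_argument[OF assms(1,2), of r "q ^ m"]
        normalized_Phi_shift_degree[OF assms(1), of p m "q ^ r"] IH
      by (simp add: mult.commute[of _ q] algebra_simps) (metis add_right_cancel)
  qed
qed

lemma A_coeff_mult_Phi:
  assumes "q \<noteq> 0" "p \<noteq> 0" "\<And>j. q ^ Suc j \<noteq> 1"
    and "\<And>j. inverse (of_real p) * q ^ j \<noteq> 1" "\<And>j. of_real p * q ^ Suc j \<noteq> 1"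
  shows "A_coeff q p n * Phi q p n z = normalized_Phi q (of_real p) n z"
proof -
  let ?p = "complex_of_real p"
  let ?Q = "\<lambda>a. q_shifted_factorial a q"
  have p0: "?p \<noteq> 0" using assms(2) by simp
  have "?Q (?p * q) n \<noteq> 0"
    using assms(5) by (intro q_shifted_factorial_nonzero) (simp add: mult.assoc)
  then have "A_coeff q p n * Phi q p n z = (?Q (inverse ?p) n / ?Q q n) *
      basic_hyp_2_1 q (q powi (- int n)) (?p * q) (?p * q powi (1 - int n)) (z * q)"
    using p0 by (simp add: A_coeff_def Phi_def power_int_minus)
  also have "\<dots> = (\<Sum>k\<le>n. b_series q ?p z $ k * a_series q ?p 1 $ (n - k))"
    unfolding basic_hyp_2_1_terminating[OF assms(1)] sum_distrib_left
  proof (rule sum.cong)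
    fix k assume "k \<in> {..n}"
    then have "?Q (q powi (- int n)) k / ?Q (?p * q powi (1 - int n)) k
          * (?Q (inverse ?p) n / ?Q q n) * (?p * q) ^ k
        = ?Q (inverse ?p) (n - k) / ?Q q (n - k)"
      using assms p0 by (intro q_shifted_factorial_quotient_reverse) auto
    then have "b_series q ?p z $ k * a_series q ?p 1 $ (n - k)
        = ?Q (?p * q) k / ?Q q k * (z / ?p) ^ k
          * (?Q (q powi (- int n)) k / ?Q (?p * q powi (1 - int n)) k
          * (?Q (inverse ?p) n / ?Q q n) * (?p * q) ^ k)"
      by (simp add: a_series_def b_series_def)
    \<comment> \<open>The power of \<open>?p * q\<close> supplied by the reversal turns the argument
      z/p of B into the argument zq of the hypergeometric series.\<close>
    also have "(z / ?p) ^ k = (z * q) ^ k / (?p * q) ^ k"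
      using assms(1) p0 by (simp flip: power_divide)
    finally show "?Q (inverse ?p) n / ?Q q n * (?Q (q powi (- int n)) k * ?Q (?p * q) k
          / (?Q q k * ?Q (?p * q powi (1 - int n)) k) * (z * q) ^ k)
        = b_series q ?p z $ k * a_series q ?p 1 $ (n - k)"
      using assms(1) p0 by (simp add: mult_ac)
  qed simp
  also have "\<dots> = normalized_Phi q ?p n z"
    unfolding normalized_Phi_def
    by (subst mult.commute) (simp add: fps_mult_nth atLeast0AtMost)
  finally show ?thesis .
qed

theorem mainTheorem2:
  fixes q :: complex and p :: real and n s :: nat
  assumes "norm q = 1"
    and "\<forall>m::nat. m > 0 \<longrightarrow> q ^ m \<noteq> 1"
    and "0 < p" and "p < 1"
  shows "A_coeff q p s * Phi q p s (q ^ n) = A_coeff q p n * Phi q p n (q ^ s)"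
proof -
  have q0: "q \<noteq> 0" and p0: "p \<noteq> 0" "complex_of_real p \<noteq> 0"
    using assms by auto
  have root: "q ^ Suc j \<noteq> 1" for j
    using assms(2) by blast
  \<comment> \<open>Since norm q = 1, these norms are 1/p and p, both different from 1. Hence no
    factor of (1/p;q)_n or (pq;q)_n vanishes.\<close>
  have "norm (inverse (of_real p) * q ^ j) \<noteq> 1" "norm (of_real p * q ^ Suc j) \<noteq> 1" for j
    using assms by (simp_all add: norm_mult norm_power norm_inverse del: power_Suc)
  then have "inverse (of_real p) * q ^ j \<noteq> 1" "of_real p * q ^ Suc j \<noteq> 1" for j
    by (metis norm_one)+
  note eq = A_coeff_mult_Phi[OF q0 p0(1) root this]
  show ?thesis
    unfolding eq by (rule normalized_Phi_duality[OF root p0(2) q0])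
qed

end
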